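(* Let $r\ge 3$ be an integer. Among connected $r$-regular graphs of order $n$, the minimum path number is quadratic in the order $n$. That is, there are constants $c_r, C_r>0$, depending only on $r$, such that for every integer $n\ge r+1$ with $rn$ even, $$c_r\, n^2\le \min\{\mathrm{pn}(G) : G \text{ is a connected } r\text{-regular graph of order } n\}\le C_r\, n^2 .$$
   Context: Graphs are finite and simple; the order of a graph is its number of vertices. For a graph $G$ of order $n$, the path number is $\mathrm{pn}(G)=\sum_{i=0}^{n-1}\mathrm{pn}_i(G)$, where $\mathrm{pn}_i(G)$ is the number of (not necessarily induced) subgraphs of $G$ isomorphic to the path $P_{i+1}$ on $i+1$ vertices (so paths are unoriented and single vertices count as paths of length $0$). Connected $r$-regular graphs of order $n$ exist exactly when $n\ge r+1$ and $rn$ is even (for $r\ge 3$). *)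

theory Defs
  imports Complex_Main "Graph_Theory.Digraph_Isomorphism"
begin

text \<open>
  A finite simple graph is a \<^locale>\<open>pair_graph\<close>: a finite vertex set with a symmetric irreflexive
  set of arcs, the edge \<open>uv\<close> being the pair of arcs \<open>(u, v)\<close> and \<open>(v, u)\<close>.
  The degree of a vertex is then its out-degree.
\<close>

definition regular :: "nat \<Rightarrow> 'a pair_pre_digraph \<Rightarrow> bool" where
  "regular r G \<longleftrightarrow> (\<forall>v \<in> pverts G. out_degree (with_proj G) v = r)"

(* The qualified name avoids the topological notion of connectedness. *)
definition connected_regular_graph :: "nat \<Rightarrow> nat \<Rightarrow> 'a pair_pre_digraph \<Rightarrow> bool" where
  "connected_regular_graph r n G \<longleftrightarrow>
     pair_graph G \<and> Digraph_Component.connected (with_proj G) \<and> regular r G \<and> card (pverts G) = n"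

text \<open>The path \<open>P\<^sub>n\<close> on \<open>n\<close> vertices.\<close>

definition path_graph :: "nat \<Rightarrow> nat pair_pre_digraph" where
  "path_graph n =
     \<lparr> pverts = {..<n}, parcs = {(u, v). u < n \<and> v < n \<and> (v = Suc u \<or> u = Suc v)} \<rparr>"

text \<open>
  Since \<open>path_graph\<close> is symmetric, so is every subdigraph isomorphic to it. Hence the set below
  contains exactly the undirected subgraphs of \<open>G\<close> isomorphic to \<open>P\<^bsub>i+1\<^esub>\<close>, each of them once.
\<close>

definition pn_len :: "nat \<Rightarrow> 'a pair_pre_digraph \<Rightarrow> nat" where
  "pn_len i G = card {H :: 'a pair_pre_digraph.
     subgraph (with_proj H) (with_proj G) \<and>
     digraph_iso (with_proj H) (with_proj (path_graph (i + 1)))}"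

definition pn :: "'a pair_pre_digraph \<Rightarrow> nat" where
  "pn G = (\<Sum>i<card (pverts G). pn_len i G)"

text \<open>
  Vertices are taken to be natural numbers, which covers all finite graphs up to isomorphism.
  Infinitely many graphs are considered here, but they have only finitely many path numbers
  (\<open>finite_path_numbers\<close> below), so \<^const>\<open>Min\<close> is meaningful as soon as one such graph exists.
\<close>

definition path_numbers :: "nat \<Rightarrow> nat \<Rightarrow> nat set" where
  "path_numbers r n = {pn G | G :: nat pair_pre_digraph. connected_regular_graph r n G}"

lemma pn_len_le:
  assumes "pair_graph G" "card (pverts G) = n"
  shows "pn_len i G \<le> 2 ^ n * 2 ^ (n * n)"
proof -
  interpret pair_graph G by fact
  let ?S = "{H. subgraph (with_proj H) (with_proj G) \<and>
     digraph_iso (with_proj H) (with_proj (path_graph (i + 1)))}"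
  let ?T = "Pow (pverts G) \<times> Pow (pverts G \<times> pverts G)"
  have fin: "finite (pverts G)" by (rule pair_finite_verts)
  have arcs: "parcs G \<subseteq> pverts G \<times> pverts G"
    using in_arcsD1 in_arcsD2 by auto
  have "card ?S \<le> card ?T"
  proof (rule card_inj_on_le[where f = "\<lambda>H. (pverts H, parcs H)"])
    show "inj_on (\<lambda>H. (pverts H, parcs H)) ?S"
      by (auto intro!: inj_onI)
    show "(\<lambda>H. (pverts H, parcs H)) ` ?S \<subseteq> ?T"
      using arcs by (auto simp: subgraph_def)
    show "finite ?T" using fin by simp
  qed
  then show ?thesis
    using fin assms(2) by (simp add: pn_len_def card_cartesian_product card_Pow)
qed

lemma finite_path_numbers: "finite (path_numbers r n)"
proof (rule finite_subset)
  show "path_numbers r n \<subseteq> {..n * (2 ^ n * 2 ^ (n * n))}"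
  proof
    fix p assume "p \<in> path_numbers r n"
    then obtain G :: "nat pair_pre_digraph"
      where G: "pair_graph G" "card (pverts G) = n" and p: "p = pn G"
      by (auto simp: path_numbers_def connected_regular_graph_def)
    have "pn G \<le> (\<Sum>i<n. 2 ^ n * 2 ^ (n * n))"
      unfolding pn_def G(2) by (rule sum_mono) (rule pn_len_le[OF G])
    then show "p \<in> {..n * (2 ^ n * 2 ^ (n * n))}" by (simp add: p)
  qed
qed simp

end

theory Submission
  imports Defs
begin

text \<open>
  Two distinct vertices of a connected graph are the ends of some path, and a path determines its
  ends; hence \<open>pn G \<ge> n choose 2\<close> for every connected graph of order \<open>n\<close>.

  For the upper bound take a cycle of \<open>m\<close> vertices and make each of them the only contact between
  the cycle and a bead of bounded size, in which it has degree \<open>r - 2\<close> while all other vertices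
  have degree \<open>r\<close>. A path of this necklace consists of a piece in one bead, a segment of the cycle
  and a piece in another bead. There are boundedly many pieces per bead and \<open>O(m\<^sup>2)\<close> segments, since
  a segment is given by its start, its direction and its length. A cycle rather than a tree is used
  since graphs that are regular of even degree have no bridges.
\<close>

section \<open>Paths as vertex lists\<close>

text \<open>These lists are oriented, so a path with at least two vertices occurs twice. They are
  counted only for the upper bound, where a factor of two is harmless.\<close>

definition gpaths :: "'a pair_pre_digraph \<Rightarrow> 'a list set" where
  "gpaths G = {p. p \<noteq> [] \<and> distinct p \<and> set p \<subseteq> pverts G \<and>
     successively (\<lambda>u v. (u, v) \<in> parcs G) p}"

text \<open>The arcs are given by indices, parallel to \<open>path_graph\<close>, and in both
  directions.\<close>

definition path_subgraph :: "'a list \<Rightarrow> 'a pair_pre_digraph" where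
  "path_subgraph p = \<lparr> pverts = set p,
     parcs = {(p ! i, p ! j) | i j. i < length p \<and> j < length p \<and> (j = Suc i \<or> i = Suc j)} \<rparr>"

text \<open>As \<open>p\<close> is distinct, sending a vertex to its index in \<open>p\<close> is a
  bijection, and it is the isomorphism.\<close>

lemma digraph_iso_path_subgraph:
  assumes "distinct p"
  shows "digraph_iso (with_proj (path_subgraph p)) (with_proj (path_graph (length p)))"
proof -
  define g where "g = the_inv_into {..<length p} ((!) p)"
  have inj: "inj_on ((!) p) {..<length p}"
    using assms by (simp add: inj_on_nth)
  have g: "g (p ! i) = i" if "i < length p" for i
    using the_inv_into_f_f[OF inj, of i] that by (simp add: g_def)
  have set_p: "set p = (!) p ` {..<length p}"
    by (auto simp: set_conv_nth)
  \<comment> \<open>An isomorphism record also carries an arc map and the new head and tail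
    functions; for arcs that are pairs the vertex map \<open>g\<close> dictates all of them.\<close>
  define h where "h = \<lparr> iso_verts = g, iso_arcs = map_prod g g, iso_head = snd, iso_tail = fst \<rparr>"
  have wf: "wf_digraph (with_proj (path_subgraph p))"
    by unfold_locales (auto simp: path_subgraph_def)
  have inj_g: "inj_on g (set p)"
    by (auto simp: set_p inj_on_def g)
  have arcs: "parcs (path_subgraph p) \<subseteq> set p \<times> set p"
    by (auto simp: path_subgraph_def)
  have "inj_on (map_prod g g) (set p \<times> set p)"
    using inj_g by (rule map_prod_inj_on) (rule inj_g)
  then have inj_a: "inj_on (map_prod g g) (parcs (path_subgraph p))"
    using arcs inj_on_subset by blast
  have "pre_digraph.digraph_isomorphism (with_proj (path_subgraph p)) h"
    using wf inj_g inj_a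
    by (simp add: pre_digraph.digraph_isomorphism_def h_def path_subgraph_def)
  moreover have "with_proj (path_graph (length p)) = app_iso h (with_proj (path_subgraph p))"
  proof (rule pre_digraph.equality)
    show "verts (with_proj (path_graph (length p))) = verts (app_iso h (with_proj (path_subgraph p)))"
      by (auto simp: h_def path_graph_def path_subgraph_def set_p image_image g)
    show "arcs (with_proj (path_graph (length p))) = arcs (app_iso h (with_proj (path_subgraph p)))"
    proof -
      have "(u, v) \<in> map_prod g g ` parcs (path_subgraph p)"
        if "u < length p" "v < length p" "v = Suc u \<or> u = Suc v" for u v
      proof -
        have "(p ! u, p ! v) \<in> parcs (path_subgraph p)"
          using that by (auto simp: path_subgraph_def)
        then have "map_prod g g (p ! u, p ! v) \<in> map_prod g g ` parcs (path_subgraph p)"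
          by (rule imageI)
        then show ?thesis using that by (simp add: g)
      qed
      then show ?thesis
        by (auto simp: h_def path_graph_def) (auto simp: path_subgraph_def g)
    qed
  qed (simp_all add: h_def)
  ultimately show ?thesis
    unfolding digraph_iso_def by blast
qed

text \<open>The inverse of the isomorphism, read along \<open>0, ..., k - 1\<close>, lists the
  vertices of \<open>H\<close> in path order.\<close>

lemma path_subgraph_of_digraph_iso:
  fixes H :: "'a pair_pre_digraph"
  assumes "digraph_iso (with_proj H) (with_proj (path_graph k))"
  obtains p where "distinct p" "length p = k" "H = path_subgraph p"
proof -
  obtain h where h: "pre_digraph.digraph_isomorphism (with_proj H) h"
    and eq: "with_proj (path_graph k) = app_iso h (with_proj H)"
    using assms unfolding digraph_iso_def by blast
  define g where "g = iso_verts h"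
  have wf: "wf_digraph (with_proj H)" and inj: "inj_on g (pverts H)"
    using h by (auto simp: pre_digraph.digraph_isomorphism_def g_def)
  have arc_ends: "fst a \<in> pverts H \<and> snd a \<in> pverts H" if "a \<in> parcs H" for a
    using wf_digraph.tail_in_verts[OF wf, of a] wf_digraph.head_in_verts[OF wf, of a] that by simp
  have V: "g ` pverts H = {..<k}"
    using arg_cong[OF eq, of verts] by (simp add: g_def path_graph_def)
  \<comment> \<open>Comparing tail and head functions on both sides forces the projections, so the
    arc map applies \<open>g\<close> to both ends and the arcs of \<open>H\<close> are determined by
    \<open>g\<close>.\<close>
  have tl: "iso_tail h = fst" and hd: "iso_head h = snd"
    using arg_cong[OF eq, of tail] arg_cong[OF eq, of head] by auto
  have ia: "iso_arcs h a = map_prod g g a" if "a \<in> parcs H" for a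
    using h that by (simp add: pre_digraph.digraph_isomorphism_def g_def tl hd prod_eq_iff)
  have "parcs (path_graph k) = iso_arcs h ` parcs H"
    using arg_cong[OF eq, of arcs] by simp
  then have A: "parcs (path_graph k) = map_prod g g ` parcs H"
    using ia by (simp cong: image_cong)
  define f where "f = the_inv_into (pverts H) g"
  have fg: "f (g x) = x" if "x \<in> pverts H" for x
    using the_inv_into_f_f[OF inj that] by (simp add: f_def)
  have fV: "f ` {..<k} = pverts H"
    unfolding V[symmetric] by (auto simp: image_image fg)
  have inj_f: "inj_on f {..<k}"
    unfolding V[symmetric] by (auto simp: inj_on_def fg)
  have "parcs H = map_prod f f ` map_prod g g ` parcs H"
    using arc_ends by (force simp: fg image_image)
  then have AH: "parcs H = map_prod f f ` parcs (path_graph k)"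
    by (simp add: A)
  let ?p = "map f [0..<k]"
  show ?thesis
  proof (rule that[of ?p])
    show "distinct ?p"
      using inj_f by (simp add: distinct_map atLeast0LessThan)
    show "H = path_subgraph ?p"
    proof (rule pair_pre_digraph.equality)
      show "pverts H = pverts (path_subgraph ?p)"
        using fV by (simp add: path_subgraph_def atLeast0LessThan)
      show "parcs H = parcs (path_subgraph ?p)"
        unfolding AH by (force simp: path_subgraph_def path_graph_def)
    qed simp
  qed simp
qed

text \<open>\<open>gpaths\<close> asks for the forward arcs only; the backward arcs of
  \<open>path_subgraph p\<close> come from the symmetry of \<open>G\<close>.\<close>

lemma (in pair_graph) subgraph_path_subgraph_iff:
  assumes "distinct p" "p \<noteq> []"
  shows "subgraph (with_proj (path_subgraph p)) (with_proj G) \<longleftrightarrow> p \<in> gpaths G"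
proof
  assume *: "subgraph (with_proj (path_subgraph p)) (with_proj G)"
  have "(p ! i, p ! Suc i) \<in> parcs (path_subgraph p)" if "Suc i < length p" for i
    using that unfolding path_subgraph_def by force
  with * assms show "p \<in> gpaths G"
    by (auto simp: gpaths_def subgraph_def successively_conv_nth path_subgraph_def)
next
  assume p: "p \<in> gpaths G"
  have step: "(p ! i, p ! Suc i) \<in> parcs G" if "Suc i < length p" for i
    using p that by (auto simp: gpaths_def successively_conv_nth)
  then have "(p ! Suc i, p ! i) \<in> parcs G" if "Suc i < length p" for i
    using pair_sym_arcs that by (auto simp: symmetric_def sym_def)
  with step have "parcs (path_subgraph p) \<subseteq> parcs G"
    by (auto simp: path_subgraph_def)
  moreover have "wf_digraph (with_proj (path_subgraph p))"
    by unfold_locales (auto simp: path_subgraph_def)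
  moreover have "wf_digraph (with_proj G)"
    by unfold_locales
  ultimately show "subgraph (with_proj (path_subgraph p)) (with_proj G)"
    using p by (auto simp: subgraph_def compatible_def gpaths_def path_subgraph_def)
qed

lemma (in pair_graph) path_subgraphs_eq:
  "{H. subgraph (with_proj H) (with_proj G) \<and> digraph_iso (with_proj H) (with_proj (path_graph (i + 1)))}
     = path_subgraph ` {p \<in> gpaths G. length p = Suc i}" (is "?L = ?R")
proof
  show "?L \<subseteq> ?R"
  proof
    fix H assume "H \<in> ?L"
    then have H: "subgraph (with_proj H) (with_proj G)"
      and iso: "digraph_iso (with_proj H) (with_proj (path_graph (i + 1)))" by auto
    obtain p where p: "distinct p" "length p = i + 1" "H = path_subgraph p"
      using path_subgraph_of_digraph_iso[OF iso] .
    then have "p \<noteq> []" by auto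
    then have "p \<in> gpaths G"
      using subgraph_path_subgraph_iff H p by blast
    then show "H \<in> ?R" using p by auto
  qed
  show "?R \<subseteq> ?L"
  proof
    fix H assume "H \<in> ?R"
    then obtain p where p: "p \<in> gpaths G" "length p = Suc i" "H = path_subgraph p" by auto
    then have "distinct p" "p \<noteq> []" by (auto simp: gpaths_def)
    then show "H \<in> ?L"
      using p subgraph_path_subgraph_iff[of p] digraph_iso_path_subgraph[of p] by auto
  qed
qed

lemma (in pair_graph) finite_gpaths: "finite (gpaths G)"
proof (rule finite_subset)
  show "gpaths G \<subseteq> {p. set p \<subseteq> pverts G \<and> distinct p}"
    by (auto simp: gpaths_def)
qed (rule finite_subset_distinct[OF pair_finite_verts])

lemma (in pair_graph) pn_le_card_gpaths: "pn G \<le> card (gpaths G)"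
proof -
  let ?P = "\<lambda>i. {p \<in> gpaths G. length p = Suc i}"
  have "pn G \<le> (\<Sum>i<card (pverts G). card (?P i))"
    unfolding pn_def pn_len_def path_subgraphs_eq
    by (intro sum_mono card_image_le) (simp add: finite_gpaths)
  also have "\<dots> = card (\<Union>i<card (pverts G). ?P i)"
    by (rule card_UN_disjoint[symmetric]) (auto simp: finite_gpaths)
  also have "\<dots> \<le> card (gpaths G)"
    by (rule card_mono) (auto simp: finite_gpaths)
  finally show ?thesis .
qed

section \<open>Ends of paths and the lower bound\<close>

text \<open>The only vertex of a one-vertex path is a leaf in this sense.\<close>

definition leaves :: "'a pair_pre_digraph \<Rightarrow> 'a set" where
  "leaves H = {x \<in> pverts H. \<forall>y z. (x, y) \<in> parcs H \<longrightarrow> (x, z) \<in> parcs H \<longrightarrow> y = z}"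

text \<open>An inner vertex of a path has two different neighbours, an end has at most one. Hence
  the ends can be recovered from the subgraph alone, without an orientation.\<close>

lemma leaves_path_subgraph:
  assumes "distinct p" "p \<noteq> []"
  shows "leaves (path_subgraph p) = {hd p, last p}"
proof -
  have V: "pverts (path_subgraph p) = set p"
    by (simp add: path_subgraph_def)
  have nbr: "(p ! i, y) \<in> parcs (path_subgraph p) \<longleftrightarrow>
      (\<exists>j<length p. y = p ! j \<and> (j = Suc i \<or> i = Suc j))" if "i < length p" for i y
    using that assms(1) by (auto simp: path_subgraph_def nth_eq_iff_index_eq)
  have *: "p ! i \<in> leaves (path_subgraph p) \<longleftrightarrow> i = 0 \<or> i = length p - 1" if i: "i < length p" for i
  proof -
    have "p ! i \<in> leaves (path_subgraph p) \<longleftrightarrow>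
        (\<forall>y z. (\<exists>j<length p. y = p ! j \<and> (j = Suc i \<or> i = Suc j)) \<longrightarrow>
          (\<exists>j<length p. z = p ! j \<and> (j = Suc i \<or> i = Suc j)) \<longrightarrow> y = z)"
      using i by (simp add: leaves_def V nbr)
    also have "\<dots> \<longleftrightarrow> (\<forall>j<length p. \<forall>k<length p. (j = Suc i \<or> i = Suc j) \<longrightarrow>
        (k = Suc i \<or> i = Suc k) \<longrightarrow> p ! j = p ! k)"
      by blast
    also have "\<dots> \<longleftrightarrow> (\<forall>j<length p. \<forall>k<length p. (j = Suc i \<or> i = Suc j) \<longrightarrow>
        (k = Suc i \<or> i = Suc k) \<longrightarrow> j = k)"
      using assms(1) by (simp add: nth_eq_iff_index_eq)
    also have "\<dots> \<longleftrightarrow> i = 0 \<or> i = length p - 1"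
    proof (cases i)
      case (Suc l)
      then show ?thesis
      proof (cases "Suc i < length p")
        case True
        then have "\<not> (\<forall>j<length p. \<forall>k<length p. (j = Suc i \<or> i = Suc j) \<longrightarrow>
            (k = Suc i \<or> i = Suc k) \<longrightarrow> j = k)"
          using Suc by (intro notI) (drule spec[of _ "Suc i"], drule mp, assumption, drule spec[of _ l], simp)
        moreover have "\<not> (i = 0 \<or> i = length p - 1)"
          using Suc True by simp
        ultimately show ?thesis by (simp only:)
      next
        case False
        with i have "i = length p - 1" by simp
        with False show ?thesis by auto
      qed
    qed simp
    finally show ?thesis .
  qed
  have ends: "hd p = p ! 0" "last p = p ! (length p - 1)" "0 < length p" "length p - 1 < length p"
    using assms(2) by (auto simp: hd_conv_nth last_conv_nth)
  show ?thesis
  proof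
    show "leaves (path_subgraph p) \<subseteq> {hd p, last p}"
    proof
      fix x assume x: "x \<in> leaves (path_subgraph p)"
      then have "x \<in> set p" by (simp add: leaves_def V)
      then obtain i where i: "i < length p" "x = p ! i" by (auto simp: in_set_conv_nth)
      with x * have "i = 0 \<or> i = length p - 1" by blast
      then show "x \<in> {hd p, last p}" using i ends by auto
    qed
    show "{hd p, last p} \<subseteq> leaves (path_subgraph p)"
      using * ends by simp
  qed
qed

text \<open>Induction along the walk: if the next vertex already lies on the path, the path is cut
  back to that vertex; otherwise it is extended.\<close>

lemma rtrancl_imp_path:
  assumes "(u, v) \<in> A\<^sup>*"
  obtains p where "p \<noteq> []" "distinct p" "successively (\<lambda>x y. (x, y) \<in> A) p" "hd p = u" "last p = v"
proof -
  from assms have "\<exists>p. p \<noteq> [] \<and> distinct p \<and> successively (\<lambda>x y. (x, y) \<in> A) p \<and> hd p = u \<and> last p = v"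
  proof induction
    case base
    then show ?case by (intro exI[of _ "[u]"]) simp
  next
    case (step w v)
    then obtain p where p: "p \<noteq> []" "distinct p" "successively (\<lambda>x y. (x, y) \<in> A) p"
      "hd p = u" "last p = w" by blast
    show ?case
    proof (cases "v \<in> set p")
      case True
      then obtain ys zs where "p = ys @ v # zs" by (auto dest: split_list)
      then have "p = (ys @ [v]) @ zs" by simp
      with p show ?thesis
        by (intro exI[of _ "ys @ [v]"]) (auto simp: successively_append_iff hd_append split: if_splits)
    next
      case False
      with p step(2) show ?thesis
        by (intro exI[of _ "p @ [v]"]) (auto simp: successively_append_iff)
    qed
  qed
  then show ?thesis using that by blast
qed

text \<open>The library defines connectedness by reachability inside the vertex set in the symmetric
  closure. The arcs are already symmetric and have their ends in \<open>pverts G\<close>, so plain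
  reachability is the same.\<close>

lemma (in pair_graph) connected_iff_rtrancl:
  "Digraph_Component.connected (with_proj G) \<longleftrightarrow>
     pverts G \<noteq> {} \<and> (\<forall>u\<in>pverts G. \<forall>v\<in>pverts G. (u, v) \<in> (parcs G)\<^sup>*)"
proof -
  have "(parcs G)\<^sup>s = parcs G"
    using pair_sym_arcs by (auto simp: symcl_def symmetric_def sym_def)
  moreover have "(u, v) \<in> rtrancl_on (pverts G) (parcs G) \<longleftrightarrow> (u, v) \<in> (parcs G)\<^sup>*"
    if "u \<in> pverts G" for u v
  proof
    assume "(u, v) \<in> (parcs G)\<^sup>*"
    then show "(u, v) \<in> rtrancl_on (pverts G) (parcs G)"
      using that by induction (auto intro: rtrancl_on_into_rtrancl_on dest: in_arcsD2)
  qed (rule rtrancl_on_rtranclI)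
  ultimately show ?thesis
    unfolding connected_conv by auto
qed

text \<open>The images of the path subgraphs under \<open>leaves\<close> include all two-element
  vertex sets, so there are at least \<open>n choose 2\<close> paths for
  \<open>n = card (pverts G)\<close>.\<close>

lemma (in pair_graph) square_le_pn:
  assumes conn: "Digraph_Component.connected (with_proj G)" and n: "card (pverts G) \<ge> 2"
  shows "(card (pverts G))\<^sup>2 \<le> 4 * pn G"
proof -
  let ?n = "card (pverts G)"
  let ?S = "\<lambda>i. {H. subgraph (with_proj H) (with_proj G) \<and>
      digraph_iso (with_proj H) (with_proj (path_graph (i + 1)))}"
  have fin: "finite (\<Union>i<?n. ?S i)"
    unfolding path_subgraphs_eq using finite_gpaths by auto
  have "{K. K \<subseteq> pverts G \<and> card K = 2} \<subseteq> leaves ` (\<Union>i<?n. ?S i)"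
  proof
    fix K assume "K \<in> {K. K \<subseteq> pverts G \<and> card K = 2}"
    then obtain u v where uv: "u \<in> pverts G" "v \<in> pverts G" and K: "K = {u, v}"
      by (auto simp: card_2_iff)
    then have uv': "(u, v) \<in> (parcs G)\<^sup>*" using conn connected_iff_rtrancl by blast
    obtain p where p: "p \<noteq> []" "distinct p" "successively (\<lambda>x y. (x, y) \<in> parcs G) p"
      "hd p = u" "last p = v"
      by (rule rtrancl_imp_path[OF uv'])
    have "x \<in> pverts G" if x: "x \<in> set p" for x
    proof -
      obtain i where i: "i < length p" "x = p ! i" using x by (auto simp: in_set_conv_nth)
      show ?thesis
      proof (cases i)
        case 0
        then show ?thesis using i p uv by (simp add: hd_conv_nth)
      next
        case (Suc j)
        then have "(p ! j, x) \<in> parcs G" using i p by (auto simp: successively_conv_nth)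
        then show ?thesis by (rule in_arcsD2)
      qed
    qed
    then have pG: "p \<in> gpaths G" using p by (auto simp: gpaths_def)
    obtain i where i: "length p = Suc i" using p by (cases p) auto
    have "length p \<le> ?n"
      using pG distinct_card[of p] card_mono[OF pair_finite_verts, of "set p"] by (simp add: gpaths_def)
    then have "i < ?n" using i by simp
    moreover have "path_subgraph p \<in> ?S i"
      unfolding path_subgraphs_eq using pG i by blast
    moreover have "K = leaves (path_subgraph p)"
      using p K leaves_path_subgraph by auto
    ultimately show "K \<in> leaves ` (\<Union>i<?n. ?S i)" by blast
  qed
  then have "?n choose 2 \<le> card (leaves ` (\<Union>i<?n. ?S i))"
    unfolding n_subsets[OF pair_finite_verts, symmetric] using fin by (intro card_mono) auto
  also have "\<dots> \<le> card (\<Union>i<?n. ?S i)"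
    using fin by (rule card_image_le)
  also have "\<dots> \<le> pn G"
    unfolding pn_def pn_len_def by (rule card_UN_le) simp
  finally have "2 * (?n choose 2) \<le> 2 * pn G" by simp
  moreover have "2 * (?n choose 2) = ?n * (?n - 1)"
  proof -
    have "even (?n * (?n - 1))" by (cases ?n) auto
    then show ?thesis by (simp only: choose_two dvd_mult_div_cancel)
  qed
  \<comment> \<open>With \<open>n = k + 2\<close> it is plain that
    \<open>n * n \<le> 2 * (n * (n - 1))\<close>, which accounts for the factor 4.\<close>
  moreover obtain k where "?n = k + 2"
    using n by (metis add.commute le_Suc_ex)
  ultimately show ?thesis
    by (simp add: power2_eq_square)
qed

section \<open>Circulant graphs and gadgets\<close>

text \<open>The degree is a function because a gadget has one vertex of smaller degree. Reachability
  from \<open>0\<close> suffices for connectedness since \<open>A\<close> is symmetric.\<close>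

definition conn_graph :: "nat \<Rightarrow> (nat \<Rightarrow> nat) \<Rightarrow> nat rel \<Rightarrow> bool" where
  "conn_graph n d A \<longleftrightarrow> A \<subseteq> {..<n} \<times> {..<n} \<and> sym A \<and> irrefl A \<and>
     (\<forall>x<n. card (A `` {x}) = d x) \<and> (\<forall>x<n. (0, x) \<in> A\<^sup>*)"

lemma conn_graph_connected_regular:
  assumes "conn_graph n (\<lambda>_. r) A" "n > 0"
  shows "connected_regular_graph r n \<lparr> pverts = {..<n}, parcs = A \<rparr>" (is "connected_regular_graph r n ?G")
proof -
  have A: "A \<subseteq> {..<n} \<times> {..<n}" "sym A" "irrefl A" "\<And>x. x < n \<Longrightarrow> card (A `` {x}) = r"
    "\<And>x. x < n \<Longrightarrow> (0, x) \<in> A\<^sup>*"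
    using assms by (auto simp: conn_graph_def)
  have "finite A" using A(1) by (rule finite_subset) simp
  interpret pair_graph ?G
    using A \<open>finite A\<close> by unfold_locales (auto simp: symmetric_def irrefl_def)
  have "(x, y) \<in> A\<^sup>*" if "x < n" "y < n" for x y
    using A(5)[OF that(1)] A(5)[OF that(2)] sym_rtrancl[OF A(2)]
    by (meson rtrancl_trans symE)
  then have "Digraph_Component.connected (with_proj ?G)"
    unfolding connected_iff_rtrancl using assms(2) by auto
  moreover have "regular r ?G"
    unfolding regular_def out_degree_def
  proof
    fix v assume "v \<in> pverts ?G"
    then have "v < n" by simp
    have "out_arcs (with_proj ?G) v = Pair v ` (A `` {v})"
      by (auto simp: out_arcs_def)
    then show "card (out_arcs (with_proj ?G) v) = r"
      using A(4)[OF \<open>v < n\<close>] by (simp add: card_image inj_on_def)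
  qed
  moreover have "pair_graph ?G" by unfold_locales
  ultimately show ?thesis
    by (simp add: connected_regular_graph_def)
qed

text \<open>The circulant digraph on the integers modulo \<open>b\<close> with connection set
  \<open>S\<close>.\<close>

definition circ :: "nat \<Rightarrow> nat set \<Rightarrow> nat rel" where
  "circ b S = {(x, y). x < b \<and> y < b \<and> (\<exists>s\<in>S. y = (x + s) mod b)}"

lemma mod_add_if:
  fixes x s b :: nat
  assumes "x < b" "s < b"
  shows "(x + s) mod b = (if x + s < b then x + s else x + s - b)"
  using assms by (auto simp: le_mod_geq)

text \<open>A step by \<open>s\<close> is undone by a step by \<open>b - s\<close>.\<close>

lemma sym_circ:
  assumes "S \<subseteq> {1..<b}" "\<And>s. s \<in> S \<Longrightarrow> b - s \<in> S"
  shows "sym (circ b S)"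
proof (rule symI)
  fix x y assume "(x, y) \<in> circ b S"
  then obtain s where s: "x < b" "y < b" "s \<in> S" "y = (x + s) mod b"
    by (auto simp: circ_def)
  then have "s < b" using assms(1) by auto
  have "x = (y + (b - s)) mod b"
  proof (cases "x + s < b")
    case True
    then have "y + (b - s) = x + b" unfolding s(4) using \<open>s < b\<close> by simp
    then show ?thesis using s(1) by (simp only: mod_add_self2 mod_less)
  next
    case False
    then have "y + (b - s) = x"
      unfolding s(4) mod_add_if[OF s(1) \<open>s < b\<close>] using \<open>s < b\<close> by simp
    then show ?thesis using s(1) by (simp only: mod_less)
  qed
  then show "(y, x) \<in> circ b S"
    unfolding circ_def using s(1,2) assms(2)[OF s(3)] by blast
qed

lemma irrefl_circ:
  assumes "S \<subseteq> {1..<b}"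
  shows "irrefl (circ b S)"
proof (rule irreflI)
  fix x show "(x, x) \<notin> circ b S"
    using assms by (auto simp: circ_def mod_add_if subset_iff split: if_splits)
qed

lemma card_circ:
  assumes "S \<subseteq> {1..<b}" "x < b"
  shows "card (circ b S `` {x}) = card S"
proof -
  have "circ b S `` {x} = (\<lambda>s. (x + s) mod b) ` S"
    using assms by (auto simp: circ_def)
  moreover have "inj_on (\<lambda>s. (x + s) mod b) S"
  proof (rule inj_onI)
    fix s t assume "s \<in> S" "t \<in> S" and eq: "(x + s) mod b = (x + t) mod b"
    then have "s < b" "t < b" using assms(1) by auto
    then show "s = t"
      using eq assms(2) by (simp add: mod_add_if split: if_splits)
  qed
  ultimately show ?thesis by (simp add: card_image)
qed

lemma rtrancl_map:
  assumes "(x, y) \<in> R\<^sup>*" "\<And>a b. (a, b) \<in> R \<Longrightarrow> (f a, f b) \<in> S"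
  shows "(f x, f y) \<in> S\<^sup>*"
  using assms(1) by induction (auto intro: rtrancl_into_rtrancl assms(2))

lemma rtrancl_consecutive:
  fixes A :: "nat rel"
  assumes "\<And>i. a \<le> i \<Longrightarrow> Suc i < b \<Longrightarrow> (i, Suc i) \<in> A" "a \<le> x" "x < b"
  shows "(a, x) \<in> A\<^sup>*"
  using assms(2,3)
proof (induction x rule: dec_induct)
  case (step k)
  then have "(a, k) \<in> A\<^sup>*" "(k, Suc k) \<in> A" using assms(1) by auto
  then show ?case by (rule rtrancl_into_rtrancl)
qed simp

text \<open>The residues of \<plusminus>1, ..., \<plusminus>\<open>r div 2\<close> modulo
  \<open>b\<close>, together with the antipode \<open>b div 2\<close> if \<open>r\<close> is odd, in
  which case \<open>even (r * b)\<close> makes \<open>b\<close> even.\<close>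

definition offsets :: "nat \<Rightarrow> nat \<Rightarrow> nat set" where
  "offsets b r = {1..r div 2} \<union> {b - r div 2..<b} \<union> (if odd r then {b div 2} else {})"

lemma offsets:
  assumes "r \<ge> 2" "r < b" "even (r * b)"
  shows "offsets b r \<subseteq> {1..<b}" "s \<in> offsets b r \<Longrightarrow> b - s \<in> offsets b r" "card (offsets b r) = r"
proof -
  show "offsets b r \<subseteq> {1..<b}"
    using assms by (auto simp: offsets_def)
  show "b - s \<in> offsets b r" if "s \<in> offsets b r"
  proof (cases "odd r")
    case True
    then have "even b" using assms by simp
    then have "b - b div 2 = b div 2" by presburger
    then show ?thesis using that assms by (auto simp: offsets_def)
  qed (use that assms in \<open>auto simp: offsets_def\<close>)
  have c: "card ({1..r div 2} \<union> {b - r div 2..<b}) = r div 2 + r div 2"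
    using assms by (subst card_Un_disjoint) auto
  show "card (offsets b r) = r"
  proof (cases "odd r")
    case True
    then have "even b" using assms by simp
    then have "b div 2 \<notin> {1..r div 2} \<union> {b - r div 2..<b}" using True assms by auto
    then show ?thesis using c True by (simp add: offsets_def) presburger
  next
    case False
    then show ?thesis using c by (simp add: offsets_def) presburger
  qed
qed

text \<open>The offset 1 joins consecutive numbers, which makes the circulant graph
  connected.\<close>

lemma circulant_conn_graph:
  assumes "r \<ge> 2" "r < b" "even (r * b)"
  shows "conn_graph b (\<lambda>_. r) (circ b (offsets b r))"
proof -
  have "(i, Suc i) \<in> circ b (offsets b r)" if "Suc i < b" for i
    using that assms(1) by (auto simp: circ_def offsets_def intro!: bexI[of _ 1])
  then have "(0, x) \<in> (circ b (offsets b r))\<^sup>*" if "x < b" for x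
    using that by (intro rtrancl_consecutive) auto
  then show ?thesis
    using offsets[OF assms] by (auto simp: conn_graph_def sym_circ irrefl_circ card_circ) (auto simp: circ_def)
qed

text \<open>
  In a circulant graph replace the edges from \<open>0\<close> to \<open>h = r div 2\<close> and to \<open>b - h\<close> by an edge between
  these two neighbours, which are not adjacent because \<open>2h\<close> is not an offset.
\<close>

lemma gadget_exists:
  assumes "r \<ge> 3" "b > 2 * r" "even (r * b)"
  shows "\<exists>L. conn_graph b (\<lambda>x. if x = 0 then r - 2 else r) L"
proof -
  define S where "S = offsets b r"
  define C where "C = circ b S"
  define h where "h = r div 2"
  define k where "k = b - h"
  have S: "S \<subseteq> {1..<b}" "\<And>s. s \<in> S \<Longrightarrow> b - s \<in> S" "card S = r"
    using offsets[of r b] assms unfolding S_def by auto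
  have hk: "0 < h" "h < k" "k < b" "h < b"
    using assms by (auto simp: h_def k_def)
  have hS: "h \<in> S" "k \<in> S"
    using hk by (auto simp: S_def offsets_def h_def k_def)
  have symC: "sym C" and irrC: "irrefl C" and cardC: "\<And>x. x < b \<Longrightarrow> card (C `` {x}) = r"
    using S by (auto simp: C_def sym_circ irrefl_circ card_circ)
  have subC: "C \<subseteq> {..<b} \<times> {..<b}" by (auto simp: C_def circ_def)
  have finC: "finite (C `` {x})" for x
    by (rule finite_subset[of _ "{..<b}"]) (use subC in auto)
  have "(0, h) \<in> C" "(0, k) \<in> C"
    using hk bexI[OF _ hS(1), of "\<lambda>s. h = s mod b"] bexI[OF _ hS(2), of "\<lambda>s. k = s mod b"]
    by (auto simp: C_def circ_def)
  then have inC: "(0, h) \<in> C" "(0, k) \<in> C" "(h, 0) \<in> C" "(k, 0) \<in> C"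
    using symC by (auto dest: symD)
  have "(h, k) \<notin> C"
  proof
    assume "(h, k) \<in> C"
    then obtain s where s: "s \<in> S" "k = (h + s) mod b" by (auto simp: C_def circ_def)
    then have "s < b" using S(1) by auto
    then have "s = b - 2 * h" using s(2) hk by (auto simp: mod_add_if k_def split: if_splits)
    \<comment> \<open>Since \<open>b > 2 * r\<close>, the number \<open>b - 2 * h\<close> lies
      strictly between \<open>h\<close> and \<open>b - h\<close>, hence between the two blocks of
      offsets, and \<open>b > 4 * h\<close> separates it from \<open>b div 2\<close>.\<close>
    then show False
      using s(1) assms hk by (auto simp: S_def offsets_def h_def k_def split: if_splits)
  qed
  then have notC: "(h, k) \<notin> C" "(k, h) \<notin> C" using symC by (auto dest: symD)
  define L where "L = (C - {(0, h), (h, 0), (0, k), (k, 0)}) \<union> {(h, k), (k, h)}"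
  have "sym L" using symC by (auto simp: L_def sym_def)
  moreover have "irrefl L" using irrC hk by (auto simp: L_def irrefl_def)
  moreover have "L \<subseteq> {..<b} \<times> {..<b}" using subC hk by (auto simp: L_def)
  moreover have deg: "card (L `` {x}) = (if x = 0 then r - 2 else r)" if "x < b" for x
  proof -
    \<comment> \<open>Vertex \<open>0\<close> loses two neighbours, \<open>h\<close> and
      \<open>k\<close> each exchange \<open>0\<close> for the other, and all other neighbourhoods
      stay the same.\<close>
    consider "x = 0" | "x = h" | "x = k" | "x \<noteq> 0" "x \<noteq> h" "x \<noteq> k" by blast
    then show ?thesis
    proof cases
      case 1
      then have "L `` {x} = C `` {0} - {h, k}" using hk by (auto simp: L_def)
      moreover have "card (C `` {0} - {h, k}) = card (C `` {0}) - card {h, k}"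
        by (rule card_Diff_subset) (use inC in auto)
      ultimately show ?thesis using 1 cardC that hk by simp
    next
      case 2
      then have "L `` {x} = insert k (C `` {h} - {0})" using hk by (auto simp: L_def)
      then show ?thesis using 2 cardC that hk inC notC finC assms
        by (simp add: card_insert_if card_Diff_singleton)
    next
      case 3
      then have "L `` {x} = insert h (C `` {k} - {0})" using hk by (auto simp: L_def)
      then show ?thesis using 3 cardC that hk inC notC finC assms
        by (simp add: card_insert_if card_Diff_singleton)
    next
      case 4
      then have "L `` {x} = C `` {x}" using hk by (auto simp: L_def)
      then show ?thesis using 4 cardC that by simp
    qed
  qed
  moreover have "(0, x) \<in> L\<^sup>*" if "x < b" for x
  proof -
    \<comment> \<open>Only edges at \<open>0\<close> were deleted, so the vertices from
      \<open>1\<close> on still form a path.\<close>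
    have "(i, Suc i) \<in> L" if "1 \<le> i" "Suc i < b" for i
      using that hk assms
      by (auto simp: L_def C_def S_def circ_def offsets_def intro!: bexI[of _ 1])
    then have from1: "(1, y) \<in> L\<^sup>*" if "1 \<le> y" "y < b" for y
      using that by (intro rtrancl_consecutive) auto
    \<comment> \<open>As \<open>r \<ge> 3\<close>, vertex \<open>0\<close> keeps a neighbour
      \<open>y\<close>, which ties it to that path.\<close>
    have "card (L `` {0}) \<noteq> 0" using deg[of 0] hk assms by simp
    then obtain y where y: "(0, y) \<in> L" by (metis card.empty Image_singleton_iff equals0I)
    have "y \<noteq> 0" using y \<open>irrefl L\<close> by (metis irrefl_def)
    moreover have "y < b" using y \<open>L \<subseteq> _\<close> by blast
    ultimately have "(1, y) \<in> L\<^sup>*" by (intro from1) auto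
    then have "(y, 1) \<in> L\<^sup>*" using sym_rtrancl[OF \<open>sym L\<close>] by (auto dest: symD)
    show ?thesis
    proof (cases "x = 0")
      case False
      then have "(1, x) \<in> L\<^sup>*" using that by (intro from1) auto
      with y \<open>(y, 1) \<in> L\<^sup>*\<close> show ?thesis by (meson converse_rtrancl_into_rtrancl rtrancl_trans)
    qed simp
  qed
  ultimately show ?thesis
    unfolding conn_graph_def by blast
qed

section \<open>The necklace\<close>

text \<open>
  Bead \<open>i\<close> occupies the numbers from \<open>i * B\<close> on, its vertex on the ring being \<open>i * B\<close> itself;
  the last bead absorbs the remainder of \<open>n\<close> modulo \<open>B\<close>.
\<close>

locale necklace =
  fixes B m n r :: nat and L :: "nat \<Rightarrow> nat rel"
  assumes B: "B > 0" and m: "m \<ge> 3" and n: "m * B \<le> n" "n < (m + 1) * B" and r: "r \<ge> 3"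
    and L: "\<And>i. i < m \<Longrightarrow>
      conn_graph (if Suc i = m then n - i * B else B) (\<lambda>x. if x = 0 then r - 2 else r) (L i)"
begin

definition bead :: "nat \<Rightarrow> nat" where "bead v = min (v div B) (m - 1)"

definition pos :: "nat \<Rightarrow> nat" where "pos v = v - bead v * B"

definition bead_size :: "nat \<Rightarrow> nat" where "bead_size i = (if Suc i = m then n - i * B else B)"

text \<open>The cycle on the bead indices; \<open>m \<ge> 3\<close> makes the offsets
  \<open>1\<close> and \<open>m - 1\<close> different.\<close>

definition ring :: "nat rel" where "ring = circ m (offsets m 2)"

definition arcs :: "nat rel" where
  "arcs = {(u, v). u < n \<and> v < n \<and> (bead u = bead v \<and> (pos u, pos v) \<in> L (bead u) \<or>
     pos u = 0 \<and> pos v = 0 \<and> (bead u, bead v) \<in> ring)}"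

lemma bead_less: "bead v < m"
  using m by (auto simp: bead_def)

lemma bead_pos: "v = bead v * B + pos v"
proof -
  have "bead v * B \<le> v div B * B" by (simp add: bead_def)
  also have "\<dots> \<le> v" by simp
  finally show ?thesis by (simp add: pos_def)
qed

lemma pos_less_bead_size: "v < n \<Longrightarrow> pos v < bead_size (bead v)"
proof -
  assume v: "v < n"
  show ?thesis
  proof (cases "Suc (bead v) = m")
    case True
    then show ?thesis using v bead_pos[of v] by (simp add: bead_size_def)
  next
    case False
    then have "bead v = v div B" using bead_less[of v] by (auto simp: bead_def min_def split: if_splits)
    then have "pos v = v mod B" by (simp add: pos_def minus_div_mult_eq_mod)
    then show ?thesis using False B by (simp add: bead_size_def)
  qed
qed

lemma
  assumes "i < m" "x < bead_size i"
  shows bead_enc: "bead (i * B + x) = i" and pos_enc: "pos (i * B + x) = x" and enc_less: "i * B + x < n"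
proof -
  show *: "bead (i * B + x) = i"
  proof (cases "Suc i = m")
    case True
    then show ?thesis using B by (auto simp: bead_def)
  next
    case False
    then show ?thesis using assms by (simp add: bead_def bead_size_def)
  qed
  then show "pos (i * B + x) = x" by (simp add: pos_def)
  show "i * B + x < n"
  proof (cases "Suc i = m")
    case True
    then show ?thesis using assms by (simp add: bead_size_def)
  next
    case False
    have "i * B + x < Suc i * B" using False assms by (simp add: bead_size_def)
    also have "\<dots> \<le> m * B" using assms(1) by (intro mult_right_mono) auto
    finally show ?thesis using n(1) by simp
  qed
qed

lemma bead_size_pos: "i < m \<Longrightarrow> 0 < bead_size i"
proof -
  assume "i < m"
  moreover have "i * B < n" if "Suc i = m"
  proof -
    have "i * B < m * B" using that B by auto
    then show ?thesis using n(1) by (rule less_le_trans)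
  qed
  ultimately show ?thesis using B by (simp add: bead_size_def)
qed

text \<open>The last bead is one block plus a remainder smaller than \<open>B\<close>. The bound
  does not involve \<open>n\<close>, on which the quadratic estimate rests.\<close>

lemma bead_size_le: "i < m \<Longrightarrow> bead_size i \<le> 2 * B"
  using n(2) by (auto simp: bead_size_def algebra_simps)

lemmas root_enc = bead_enc[where x = 0, OF _ bead_size_pos, simplified]
  pos_enc[where x = 0, OF _ bead_size_pos, simplified] enc_less[where x = 0, OF _ bead_size_pos, simplified]

lemma bead_graph: "i < m \<Longrightarrow> conn_graph (bead_size i) (\<lambda>x. if x = 0 then r - 2 else r) (L i)"
  using L[of i] unfolding bead_size_def .

lemma ring: "conn_graph m (\<lambda>_. 2) ring"
  unfolding ring_def using m by (intro circulant_conn_graph) auto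

text \<open>A vertex at position \<open>0\<close> has \<open>r - 2\<close> neighbours in its bead
  and two on the ring; any other vertex has all its \<open>r\<close> neighbours in its bead. Every
  vertex is reached from \<open>0\<close> by going round the ring to its bead and then inside the
  bead.\<close>

lemma conn_graph_arcs: "conn_graph n (\<lambda>_. r) arcs"
  unfolding conn_graph_def
proof (intro conjI allI impI)
  show "arcs \<subseteq> {..<n} \<times> {..<n}" by (auto simp: arcs_def)
  have symL: "sym (L i)" and irrL: "irrefl (L i)" and subL: "L i \<subseteq> {..<bead_size i} \<times> {..<bead_size i}"
    and cardL: "\<And>x. x < bead_size i \<Longrightarrow> card (L i `` {x}) = (if x = 0 then r - 2 else r)"
    and connL: "\<And>x. x < bead_size i \<Longrightarrow> (0, x) \<in> (L i)\<^sup>*" if "i < m" for i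
    using bead_graph[OF that] by (auto simp: conn_graph_def)
  have symR: "sym ring" and irrR: "irrefl ring" and subR: "ring \<subseteq> {..<m} \<times> {..<m}"
    and cardR: "\<And>x. x < m \<Longrightarrow> card (ring `` {x}) = 2"
    and connR: "\<And>x. x < m \<Longrightarrow> (0, x) \<in> ring\<^sup>*"
    using ring by (auto simp: conn_graph_def)
  show "sym arcs"
    using symL[OF bead_less] symR by (auto simp: sym_def arcs_def)
  show "irrefl arcs"
    using irrL[OF bead_less] irrR by (auto simp: irrefl_def arcs_def)
  fix u assume u: "u < n"
  define i where "i = bead u"
  have i: "i < m" by (simp add: i_def bead_less)
  have pu: "pos u < bead_size i" using pos_less_bead_size[OF u] by (simp add: i_def)
  let ?I = "(\<lambda>y. i * B + y) ` (L i `` {pos u})"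
  let ?O = "if pos u = 0 then (\<lambda>j. j * B) ` (ring `` {i}) else {}"
  have "arcs `` {u} = ?I \<union> ?O"
  proof (intro equalityI subsetI)
    fix v assume "v \<in> arcs `` {u}"
    then have v: "(u, v) \<in> arcs" by simp
    then consider "bead u = bead v" "(pos u, pos v) \<in> L (bead u)"
      | "pos u = 0" "pos v = 0" "(bead u, bead v) \<in> ring"
      by (auto simp: arcs_def)
    then show "v \<in> ?I \<union> ?O"
    proof cases
      case 1
      then have "v \<in> ?I" using bead_pos[of v] by (intro image_eqI[of _ _ "pos v"]) (auto simp: i_def)
      then show ?thesis by blast
    next
      case 2
      then have "v \<in> (\<lambda>j. j * B) ` (ring `` {i})"
        using bead_pos[of v] by (intro image_eqI[of _ _ "bead v"]) (auto simp: i_def)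
      then show ?thesis using 2 by simp
    qed
  next
    fix v assume "v \<in> ?I \<union> ?O"
    then consider y where "v = i * B + y" "(pos u, y) \<in> L i"
      | j where "v = j * B" "pos u = 0" "(i, j) \<in> ring"
      by (auto split: if_splits)
    then have "(u, v) \<in> arcs"
    proof cases
      case 1
      then have "y < bead_size i" using subL[OF i] by auto
      then show ?thesis using 1 u bead_enc[OF i] pos_enc[OF i] enc_less[OF i]
        by (simp add: arcs_def i_def[symmetric])
    next
      case 2
      then have "j < m" using subR by auto
      then show ?thesis using 2 u root_enc by (simp add: arcs_def i_def[symmetric])
    qed
    then show "v \<in> arcs `` {u}" by simp
  qed
  \<comment> \<open>The ring is irreflexive, so a ring neighbour lies in another bead.\<close>
  moreover have "?I \<inter> ?O = {}"
  proof -
    have "i * B + y \<noteq> j * B" if "(pos u, y) \<in> L i" "(i, j) \<in> ring" for y j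
    proof
      assume eq: "i * B + y = j * B"
      have "y < bead_size i" "j < m" using that subL[OF i] subR by auto
      then have "i = j" using arg_cong[OF eq, of bead] bead_enc[OF i] root_enc by simp
      then show False using that(2) irrR by (simp add: irrefl_def)
    qed
    then show ?thesis by auto
  qed
  moreover have "finite (L i `` {pos u})"
    by (rule finite_subset[of _ "{..<bead_size i}"]) (use subL[OF i] in auto)
  then have "finite ?I" by (rule finite_imageI)
  moreover have "finite (ring `` {i})"
    by (rule finite_subset[of _ "{..<m}"]) (use subR in auto)
  then have "finite ?O" by simp
  moreover have "card ?I = card (L i `` {pos u})"
    by (intro card_image) (auto simp: inj_on_def)
  moreover have "card ((\<lambda>j. j * B) ` (ring `` {i})) = card (ring `` {i})"
    using B by (intro card_image) (auto simp: inj_on_def)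
  moreover have r2: "Suc (Suc (r - 2)) = r" using r by simp
  ultimately show "card (arcs `` {u}) = r"
    using cardL[OF i pu] cardR[OF i] r2 by (simp add: card_Un_disjoint)
  have "(0 * B, i * B) \<in> arcs\<^sup>*"
  proof (rule rtrancl_map[where f = "\<lambda>j. j * B", OF connR[OF i]])
    fix a b assume ab: "(a, b) \<in> ring"
    then have "a < m" "b < m" using subR by auto
    then show "(a * B, b * B) \<in> arcs" using ab root_enc by (simp add: arcs_def)
  qed
  moreover have "(i * B + 0, i * B + pos u) \<in> arcs\<^sup>*"
  proof (rule rtrancl_map[where f = "\<lambda>y. i * B + y", OF connL[OF i pu]])
    fix a b assume ab: "(a, b) \<in> L i"
    then have "a < bead_size i" "b < bead_size i" using subL[OF i] by auto
    then show "(i * B + a, i * B + b) \<in> arcs"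
      using ab bead_enc[OF i] pos_enc[OF i] enc_less[OF i] by (simp add: arcs_def)
  qed
  moreover have "u = i * B + pos u" using bead_pos[of u] by (simp add: i_def)
  ultimately show "(0, u) \<in> arcs\<^sup>*" by simp
qed

section \<open>Shape of the paths in the necklace\<close>

abbreviation walk :: "nat list \<Rightarrow> bool" where
  "walk \<equiv> successively (\<lambda>u v. (u, v) \<in> arcs)"

lemma arc_nonroot:
  assumes "(x, y) \<in> arcs" "pos x \<noteq> 0 \<or> pos y \<noteq> 0"
  shows "bead y = bead x"
  using assms by (auto simp: arcs_def)

text \<open>A bead can be left only through its vertex on the ring, which is
  \<open>bead x * B\<close>.\<close>

lemma walk_stays:
  assumes "walk (x # xs)" "pos x \<noteq> 0" "bead x * B \<notin> set xs"
  shows "\<forall>y\<in>set xs. bead y = bead x \<and> pos y \<noteq> 0"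
  using assms
proof (induction xs arbitrary: x)
  case (Cons y ys)
  then have xy: "(x, y) \<in> arcs" and w: "walk (y # ys)" by auto
  have b: "bead y = bead x" using arc_nonroot[OF xy] Cons.prems by simp
  have "pos y \<noteq> 0"
  proof
    assume "pos y = 0"
    then have "y = bead x * B" using bead_pos[of y] b by simp
    then show False using Cons.prems by simp
  qed
  then show ?case using Cons.IH[OF w] Cons.prems b by auto
qed simp

text \<open>Here \<open>q\<close> is the ring segment and \<open>s\<close> the final piece. When the
  path leaves the ring, it has just used the only exit of the bead that it enters, so by
  distinctness it is trapped there.\<close>

lemma walk_from_root:
  assumes "walk (x # xs)" "distinct (x # xs)" "pos x = 0"
  shows "\<exists>q s. x # xs = q @ s \<and> q \<noteq> [] \<and> (\<forall>y\<in>set q. pos y = 0) \<and> (\<forall>y\<in>set s. bead y = bead (last q))"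
  using assms
proof (induction xs arbitrary: x)
  case Nil
  then show ?case by - (rule exI[of _ "[x]"], rule exI[of _ "[]"], auto)
next
  case (Cons y ys)
  then have xy: "(x, y) \<in> arcs" and w: "walk (y # ys)" by auto
  show ?case
  proof (cases "pos y = 0")
    case True
    then obtain q s where qs: "y # ys = q @ s" "q \<noteq> []" "\<forall>z\<in>set q. pos z = 0"
      "\<forall>z\<in>set s. bead z = bead (last q)"
      using Cons.IH[OF w] Cons.prems by auto
    then show ?thesis
      using Cons.prems by - (rule exI[of _ "x # q"], rule exI[of _ s], auto)
  next
    case False
    then have b: "bead y = bead x" using arc_nonroot[OF xy] by simp
    have "x = bead y * B" using bead_pos[of x] Cons.prems b by simp
    then have "bead y * B \<notin> set ys" using Cons.prems by auto
    then have "\<forall>z\<in>set ys. bead z = bead y" using walk_stays[OF w False] by blast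
    then show ?thesis
      using Cons.prems b by - (rule exI[of _ "[x]"], rule exI[of _ "y # ys"], auto)
  qed
qed

text \<open>The cut is made before the first vertex on the ring. Each arc up to that vertex has an
  end off the ring and therefore stays in the first bead.\<close>

lemma walk_to_root:
  assumes "walk p"
  shows "\<exists>a w. p = a @ w \<and> (w = [] \<or> pos (hd w) = 0 \<and> bead (hd w) = bead (hd p)) \<and>
    (\<forall>y\<in>set a. bead y = bead (hd p))"
  using assms
proof (induction p)
  case (Cons x xs)
  show ?case
  proof (cases "pos x = 0 \<or> xs = []")
    case True
    then show ?thesis
    proof
      assume "pos x = 0"
      then show ?thesis by - (rule exI[of _ "[]"], rule exI[of _ "x # xs"], auto)
    next
      assume "xs = []"
      then show ?thesis by - (rule exI[of _ "[x]"], rule exI[of _ "[]"], auto)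
    qed
  next
    case False
    then obtain y ys where xs: "xs = y # ys" by (cases xs) auto
    then have "(x, y) \<in> arcs" "walk xs" using Cons.prems by auto
    then have "bead y = bead x" using arc_nonroot False by blast
    then have b': "bead (hd xs) = bead x" using xs by simp
    obtain a w where aw: "xs = a @ w" "w = [] \<or> pos (hd w) = 0 \<and> bead (hd w) = bead (hd xs)"
      "\<forall>z\<in>set a. bead z = bead (hd xs)"
      using Cons.IH[OF \<open>walk xs\<close>] by blast
    then show ?thesis
      using b' by - (rule exI[of _ "x # a"], rule exI[of _ w], auto)
  qed
qed simp

lemma offsets_2: "offsets m 2 = {1, m - 1}"
  using m by (auto simp: offsets_def)

text \<open>A path on a cycle cannot turn back, so its first step fixes the direction
  \<open>d\<close>, where \<open>m - 1\<close> stands for -1.\<close>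

lemma ring_walk:
  assumes "successively (\<lambda>u v. (u, v) \<in> ring) c" "distinct c" "c \<noteq> []" "set c \<subseteq> {..<m}"
  shows "\<exists>d\<in>{1, m - 1}. \<forall>k<length c. c ! k = (hd c + d * k) mod m"
proof -
  have step: "\<exists>d\<in>{1, m - 1}. c ! Suc k = (c ! k + d) mod m" if "Suc k < length c" for k
    using assms(1) that by (auto simp: successively_conv_nth ring_def circ_def offsets_2)
  have c0: "c ! 0 = hd c" using assms(3) by (simp add: hd_conv_nth)
  have c0_less: "c ! 0 < m"
    unfolding c0 using assms(3,4) hd_in_set[of c] by blast
  show ?thesis
  proof (cases "length c > 1")
    case False
    then have l: "length c = 1" using assms(3) by (cases c) auto
    \<comment> \<open>A single vertex has no direction; \<open>1\<close> is an arbitrary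
      choice.\<close>
    then have "\<forall>k<length c. c ! k = (hd c + 1 * k) mod m" using c0 c0_less by simp
    then show ?thesis by blast
  next
    case True
    obtain d where d: "d \<in> {1, m - 1}" "c ! 1 = (c ! 0 + d) mod m"
      using step[of 0] True unfolding One_nat_def by blast
    have "c ! k = (c ! 0 + d * k) mod m" if "k < length c" for k
      using that
    proof (induction k rule: less_induct)
      case (less k)
      consider "k = 0" | "k = 1" | j where "k = Suc (Suc j)"
        by (metis One_nat_def nat.exhaust)
      then show ?case
      proof cases
        case 1
        then show ?thesis using c0_less by simp
      next
        case 2
        then show ?thesis using d by simp
      next
        case 3
        let ?a = "(c ! 0 + d * j)"
        have e0: "c ! j = ?a mod m" and e1: "c ! Suc j = (?a + d) mod m"
          using less.IH[of j] less.IH[of "Suc j"] less.prems 3 by (simp_all add: algebra_simps)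
        obtain e where e: "e \<in> {1, m - 1}" "c ! Suc (Suc j) = (c ! Suc j + e) mod m"
          using step[of "Suc j"] less.prems unfolding 3 by blast
        have "c ! Suc (Suc j) \<noteq> c ! j"
          using assms(2) less.prems 3 by (simp add: nth_eq_iff_index_eq)
        have "e = d"
        proof (rule ccontr)
          assume "e \<noteq> d"
          \<comment> \<open>The two offsets are opposite modulo \<open>m\<close>, so the second step
            would undo the first and revisit \<open>c ! j\<close>.\<close>
          then have "d + e = m" using e(1) d(1) m by auto
          then have "c ! Suc (Suc j) = (?a + m) mod m"
            unfolding e(2) e1 mod_add_left_eq by (simp only: add.assoc)
          then show False using \<open>c ! Suc (Suc j) \<noteq> c ! j\<close> e0 by simp
        qed
        then have "c ! Suc (Suc j) = (?a + d + d) mod m"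
          unfolding e(2) e1 mod_add_left_eq by simp
        then show ?thesis using 3 by (simp add: algebra_simps)
      qed
    qed
    then show ?thesis using d(1) c0 by auto
  qed
qed

section \<open>Encoding and counting the paths\<close>

text \<open>A common supply of position lists for the pieces in all beads. It depends on
  \<open>B\<close> alone, which keeps the final constant independent of \<open>n\<close>.\<close>

definition local_lists :: "nat list set" where
  "local_lists = {xs. set xs \<subseteq> {..<2 * B} \<and> distinct xs}"

lemma bead_list:
  assumes "distinct xs" "set xs \<subseteq> {..<n}" "\<forall>y\<in>set xs. bead y = i"
  shows "map pos xs \<in> local_lists" "xs = map (\<lambda>x. i * B + x) (map pos xs)"
proof -
  have "pos y < 2 * B" if "y \<in> set xs" for y
    using assms(2) that pos_less_bead_size[of y] bead_size_le[OF bead_less, of y] by auto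
  moreover have "inj_on pos (set xs)"
  proof (rule inj_onI)
    fix y z assume "y \<in> set xs" "z \<in> set xs" "pos y = pos z"
    then show "y = z" using assms(3) bead_pos[of y] bead_pos[of z] by simp
  qed
  ultimately show "map pos xs \<in> local_lists"
    using assms(1) by (auto simp: local_lists_def distinct_map)
  have "i * B + pos y = y" if "y \<in> set xs" for y
    using assms(3) that bead_pos[of y] by simp
  then show "xs = map (\<lambda>x. i * B + x) (map pos xs)"
    by (simp add: map_idI)
qed

text \<open>
  A path is decoded from its two pieces inside beads and from the start \<open>i\<close>, direction \<open>d\<close> and
  number of vertices \<open>l\<close> of its ring segment. If \<open>l = 0\<close>, the path stays in bead \<open>i\<close> and is the
  first piece, the second being empty.
\<close>

definition decode :: "nat list \<times> nat list \<times> nat \<times> nat \<times> nat \<Rightarrow> nat list" where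
  "decode = (\<lambda>(a, s, i, d, l). map (\<lambda>x. i * B + x) a @
     map (\<lambda>k. (i + d * k) mod m * B) [0..<l] @
     map (\<lambda>x. (i + d * (l - 1)) mod m * B + x) s)"

text \<open>\<open>walk_to_root\<close> splits off the piece in the first bead,
  \<open>walk_from_root\<close> the piece in the last one, and \<open>ring_walk\<close> describes
  what remains by start, direction and length.\<close>

lemma walk_decode:
  assumes "walk p" "distinct p" "set p \<subseteq> {..<n}"
  shows "p \<in> decode ` (local_lists \<times> local_lists \<times> {..<n} \<times> {1, m - 1} \<times> {..n})"
proof -
  define i where "i = bead (hd p)"
  have "m \<le> n" using n(1) B by (metis le_trans mult.right_neutral mult_le_mono2 Suc_leI One_nat_def)
  then have i: "i < n" using bead_less[of "hd p"] by (simp add: i_def)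
  obtain a w where p: "p = a @ w" and w: "w = [] \<or> pos (hd w) = 0 \<and> bead (hd w) = i"
    and a: "\<forall>y\<in>set a. bead y = i"
    using walk_to_root[OF assms(1)] unfolding i_def by blast
  have a': "map pos a \<in> local_lists" "a = map (\<lambda>x. i * B + x) (map pos a)"
    using bead_list[of a i] a assms p by auto
  have nil: "[] \<in> local_lists" by (simp add: local_lists_def)
  show ?thesis
  proof (cases w)
    case Nil
    \<comment> \<open>The path never meets the ring, so the ring segment is empty and the direction
      \<open>1\<close> is a dummy.\<close>
    have "p = decode (map pos a, [], i, 1, 0)"
      using p Nil a'(2) by (simp add: decode_def)
    then show ?thesis
      by (rule image_eqI) (use a' nil i in auto)
  next
    case (Cons x xs)
    have "walk w" "distinct w" using assms p by (auto simp: successively_append_iff)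
    then have "walk (x # xs)" "distinct (x # xs)" "pos x = 0" using w Cons by auto
    from walk_from_root[OF this] obtain q s where w': "w = q @ s" and q: "q \<noteq> []"
      and q0: "\<forall>y\<in>set q. pos y = 0" and s: "\<forall>y\<in>set s. bead y = bead (last q)"
      using Cons by blast
    define c where "c = map bead q"
    have qB: "y = bead y * B" if "y \<in> set q" for y
      using bead_pos[of y] q0 that by simp
    then have qc: "q = map (\<lambda>j. j * B) c"
      by (simp add: c_def map_idI)
    have "distinct q" using \<open>distinct w\<close> w' by simp
    then have dc: "distinct c" unfolding qc by (simp add: distinct_map)
    have "successively (\<lambda>u v. (bead u, bead v) \<in> ring) q"
    proof (rule successively_mono)
      show "walk q" using \<open>walk w\<close> w' by (auto simp: successively_append_iff)
      fix u v assume uv: "u \<in> set q" "v \<in> set q" "(u, v) \<in> arcs"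
      \<comment> \<open>An arc between two vertices at position \<open>0\<close> could come from a
        bead only as a loop, so it is a ring arc.\<close>
      have "(0, 0) \<notin> L (bead u)"
        using bead_graph[OF bead_less[of u]] by (auto simp: conn_graph_def irrefl_def)
      then show "(bead u, bead v) \<in> ring"
        using uv q0 by (auto simp: arcs_def)
    qed
    then have "successively (\<lambda>u v. (u, v) \<in> ring) c"
      by (simp add: c_def successively_map)
    moreover have "c \<noteq> []" "set c \<subseteq> {..<m}"
      using q bead_less by (auto simp: c_def)
    ultimately obtain d where d: "d \<in> {1, m - 1}" and cd: "\<forall>k<length c. c ! k = (hd c + d * k) mod m"
      using ring_walk[OF _ dc] by blast
    have "hd c = i" using w w' q by (simp add: c_def hd_map)
    then have c: "c = map (\<lambda>k. (i + d * k) mod m) [0..<length c]"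
      using cd by (intro nth_equalityI) auto
    have "length q \<le> n"
      using \<open>distinct q\<close> distinct_card[of q] card_mono[of "{..<n}" "set q"] assms(3) p w' by auto
    then have l: "length c \<le> n" by (simp add: c_def)
    have "bead (last q) = last c" using q by (simp add: c_def last_map)
    also have "\<dots> = (i + d * (length c - 1)) mod m"
      using cd \<open>c \<noteq> []\<close> \<open>hd c = i\<close> by (simp add: last_conv_nth)
    finally have s': "\<forall>y\<in>set s. bead y = (i + d * (length c - 1)) mod m" using s by simp
    have s'': "map pos s \<in> local_lists" "s = map (\<lambda>x. (i + d * (length c - 1)) mod m * B + x) (map pos s)"
      using bead_list[OF _ _ s'] assms p w' by auto
    have qd: "q = map (\<lambda>k. (i + d * k) mod m * B) [0..<length c]"
      unfolding qc by (subst c) (simp add: o_def)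
    have "p = decode (map pos a, map pos s, i, d, length c)"
      unfolding decode_def prod.case p w' using a'(2) s''(2) qd by metis
    then show ?thesis
      by (rule image_eqI) (use a' s'' i d l in auto)
  qed
qed

lemma finite_local_lists: "finite local_lists"
  unfolding local_lists_def by (rule finite_subset_distinct) simp

text \<open>There are \<open>card local_lists\<close> choices for each of the two pieces,
  \<open>n\<close> for the start, 2 for the direction and \<open>n + 1 \<le> 2 * n\<close> for the
  length.\<close>

lemma pn_necklace_le:
  "pn \<lparr> pverts = {..<n}, parcs = arcs \<rparr> \<le> 4 * (card local_lists)\<^sup>2 * n\<^sup>2" (is "pn ?G \<le> _")
proof -
  have "n > 0" using n(1) B m by (cases n) auto
  have "connected_regular_graph r n ?G"
    by (rule conn_graph_connected_regular[OF conn_graph_arcs \<open>n > 0\<close>])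
  then interpret pair_graph ?G by (simp add: connected_regular_graph_def)
  let ?T = "local_lists \<times> local_lists \<times> {..<n} \<times> {1, m - 1} \<times> {..n}"
  have fin: "finite ?T" using finite_local_lists by simp
  have "pn ?G \<le> card (gpaths ?G)" by (rule pn_le_card_gpaths)
  also have "\<dots> \<le> card (decode ` ?T)"
  proof (rule card_mono)
    show "gpaths ?G \<subseteq> decode ` ?T"
    proof
      fix p assume "p \<in> gpaths ?G"
      then have "walk p" "distinct p" "set p \<subseteq> {..<n}" by (auto simp: gpaths_def)
      then show "p \<in> decode ` ?T" by (rule walk_decode)
    qed
  qed (use fin in simp)
  also have "\<dots> \<le> card ?T" using fin by (rule card_image_le)
  also have "\<dots> = card local_lists * (card local_lists * (n * (2 * Suc n)))"
    using m by (simp add: card_cartesian_product)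
  also have "\<dots> \<le> card local_lists * (card local_lists * (n * (2 * (2 * n))))"
    using \<open>n > 0\<close> by (intro mult_le_mono2) simp
  also have "\<dots> = 4 * (card local_lists)\<^sup>2 * n\<^sup>2"
    by (simp add: power2_eq_square)
  finally show ?thesis .
qed

end

section \<open>The minimum path number\<close>

lemma path_numbers_nonempty:
  assumes "r \<ge> 2" "r < n" "even (r * n)"
  shows "path_numbers r n \<noteq> {}"
proof -
  have "n > 0" using assms by simp
  from conn_graph_connected_regular[OF circulant_conn_graph[OF assms] this]
  show ?thesis unfolding path_numbers_def by blast
qed

lemma Min_path_numbers_lower:
  assumes "r \<ge> 2" "r < n" "even (r * n)"
  shows "n\<^sup>2 \<le> 4 * Min (path_numbers r n)"
proof -
  have "Min (path_numbers r n) \<in> path_numbers r n"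
    by (rule Min_in[OF finite_path_numbers path_numbers_nonempty[OF assms]])
  then obtain G :: "nat pair_pre_digraph"
    where G: "connected_regular_graph r n G" and eq: "Min (path_numbers r n) = pn G"
    by (auto simp: path_numbers_def)
  then interpret pair_graph G by (simp add: connected_regular_graph_def)
  show ?thesis
    using square_le_pn G assms by (simp add: connected_regular_graph_def eq)
qed

lemma Min_path_numbers_upper:
  assumes "r \<ge> 3" "n \<ge> 12 * r" "even (r * n)"
  shows "Min (path_numbers r n) \<le> 4 * (card {xs. set xs \<subseteq> {..<2 * (4 * r)} \<and> distinct xs})\<^sup>2 * n\<^sup>2"
proof -
  \<comment> \<open>This block size exceeds \<open>2 * r\<close>, as the gadgets require, and is
    even, so that \<open>r * B\<close> is even for every \<open>r\<close>. Then
    \<open>n \<ge> 12 * r\<close> provides at least three beads.\<close>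
  define B where "B = 4 * r"
  define m where "m = n div B"
  have B: "B > 0" "B > 2 * r" "even B" using assms(1) by (auto simp: B_def)
  have "3 * B div B \<le> n div B" using assms(2) by (intro div_le_mono) (simp add: B_def)
  then have m: "m \<ge> 3" using B by (simp add: m_def)
  have n: "m * B \<le> n" "n < (m + 1) * B"
    using B dividend_less_div_times[of B n] by (simp_all add: m_def)
  have "\<exists>L. conn_graph (if Suc i = m then n - i * B else B) (\<lambda>x. if x = 0 then r - 2 else r) L"
    if "i < m" for i
  proof (cases "Suc i = m")
    case True
    then have "m * B = i * B + B" by auto
    then have "B \<le> n - i * B" using n(1) by linarith
    \<comment> \<open>Removing blocks of even size preserves the parity condition, so the enlarged
      last bead has a gadget too.\<close>
    moreover have "even (r * (n - i * B))"
      using assms(3) B by (auto simp: diff_mult_distrib2)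
    ultimately show ?thesis
      using True gadget_exists[OF assms(1), of "n - i * B"] B by simp
  next
    case False
    then show ?thesis using gadget_exists[OF assms(1), of B] B by simp
  qed
  then obtain L where L: "\<And>i. i < m \<Longrightarrow>
      conn_graph (if Suc i = m then n - i * B else B) (\<lambda>x. if x = 0 then r - 2 else r) (L i)"
    by metis
  interpret necklace B m n r L
    by unfold_locales (use B m n assms(1) L in auto)
  have "n > 0" using assms by linarith
  then have "pn \<lparr> pverts = {..<n}, parcs = arcs \<rparr> \<in> path_numbers r n"
    unfolding path_numbers_def using conn_graph_connected_regular[OF conn_graph_arcs] by blast
  then have "Min (path_numbers r n) \<le> pn \<lparr> pverts = {..<n}, parcs = arcs \<rparr>"
    using finite_path_numbers by simp
  also note pn_necklace_le
  finally show ?thesis unfolding local_lists_def unfolding B_def .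
qed

theorem theorem2:
  fixes r :: nat
  assumes "r \<ge> 3"
  shows "\<exists>c C :: real. c > 0 \<and> C > 0 \<and>
    (\<forall>n :: nat. n \<ge> r + 1 \<and> even (r * n) \<longrightarrow>
       c * (real n)\<^sup>2 \<le> real (Min (path_numbers r n)) \<and>
       real (Min (path_numbers r n)) \<le> C * (real n)\<^sup>2)"
proof -
  define K where "K = 4 * (card {xs. set xs \<subseteq> {..<2 * (4 * r)} \<and> distinct xs})\<^sup>2"
  \<comment> \<open>This bounds the finitely many orders below \<open>12 * r\<close>. If no graph of
    some order exists, its term \<open>Min {}\<close> is some natural number, which can only
    increase the bound.\<close>
  define S where "S = (\<Sum>n<12 * r. Min (path_numbers r n))"
  \<comment> \<open>\<open>K\<close> serves the large orders, \<open>S\<close> the small ones, and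
    \<open>1\<close> makes the constant positive.\<close>
  define C where "C = K + S + 1"
  have "(1 / 4) * (real n)\<^sup>2 \<le> real (Min (path_numbers r n)) \<and>
      real (Min (path_numbers r n)) \<le> real C * (real n)\<^sup>2" if "n \<ge> r + 1" "even (r * n)" for n
  proof
    have "n\<^sup>2 \<le> 4 * Min (path_numbers r n)"
      using Min_path_numbers_lower[of r n] assms that by simp
    then have "real (n\<^sup>2) \<le> real (4 * Min (path_numbers r n))" by (rule of_nat_mono)
    then show "(1 / 4) * (real n)\<^sup>2 \<le> real (Min (path_numbers r n))" by simp
    have "Min (path_numbers r n) \<le> C * n\<^sup>2"
    proof (cases "n < 12 * r")
      case True
      then have "Min (path_numbers r n) \<le> S"
        unfolding S_def by (intro member_le_sum) auto
      also have "S \<le> C * 1" by (simp add: C_def)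
      also have "\<dots> \<le> C * n\<^sup>2" using that by (intro mult_le_mono2) simp
      finally show ?thesis .
    next
      case False
      then have "Min (path_numbers r n) \<le> K * n\<^sup>2"
        using Min_path_numbers_upper[OF assms _ that(2)] by (simp add: K_def)
      also have "\<dots> \<le> C * n\<^sup>2" by (intro mult_le_mono1) (simp add: C_def)
      finally show ?thesis .
    qed
    then have "real (Min (path_numbers r n)) \<le> real (C * n\<^sup>2)" by (rule of_nat_mono)
    then show "real (Min (path_numbers r n)) \<le> real C * (real n)\<^sup>2" by simp
  qed
  moreover have "real C > 0" by (simp add: C_def)
  ultimately show ?thesis
    by (intro exI[of _ "1 / 4"] exI[of _ "real C"]) simp
qed

end
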